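(* Let $(G,\Delta,\varepsilon)$ be a comonad on a category $\mathcal{A}$ and let $L:\mathcal{B}\to\mathcal{A}$ be a functor. If $L$ has a right adjoint $R:\mathcal{A}\to\mathcal{B}$, then there is a bijective correspondence between functors $K:\mathcal{B}\to\mathcal{A}_G$ such that $UK=L$ and morphisms of comonads $\varphi:LR\to G$, where $\mathcal{A}_G$ is the category of $G$-coalgebras and $U:\mathcal{A}_G\to\mathcal{A}$ is the forgetful functor.
   Context: A comonad $(G,\Delta,\varepsilon)$ on $\mathcal{A}$ is a functor $G:\mathcal{A}\to\mathcal{A}$ with natural transformations $\Delta:G\to G^2$, $\varepsilon:G\to id_{\mathcal{A}}$ such that $G\Delta\circ\Delta=\Delta G\circ\Delta$ and $\varepsilon G\circ\Delta=id_G=G\varepsilon\circ\Delta$. The category $\mathcal{A}_G$ of $G$-coalgebras has as objects the pairs $(X,x)$ with $X$ an object of $\mathcal{A}$ and $x:X\to GX$ such that $Gx\circ x=\Delta_X\circ x$ and $\varepsilon_X\circ x=id_X$; morphisms $(X,x)\to(X',x')$ are the morphisms $f:X\to X'$ in $\mathcal{A}$ with $Gf\circ x=x'\circ f$. If $\eta$ and $\epsilon$ are the unit and counit of $L\dashv R$, then $LR$ is regarded as the comonad $(LR,\delta,\epsilon)$ with $\delta=L\eta R$. A morphism of comonads $\varphi:LR\to G$ is a natural transformation with $\Delta\circ\varphi=\varphi^2\circ\delta$ and $\varepsilon\circ\varphi=\epsilon$, where $\varphi^2_X=\varphi_{GX}\circ LR\varphi_X=G\varphi_X\circ\varphi_{LRX}$.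 The condition $UK=L$ is strict equality of functors. *)

theory Defs
  imports "HOL-Library.FuncSet"
begin

section \<open>Categories, functors, natural transformations\<close>

record ('o, 'm) cat =
  Obj :: "'o set"
  Arr :: "'m set"
  Dom :: "'m \<Rightarrow> 'o"
  Cod :: "'m \<Rightarrow> 'o"
  Id :: "'o \<Rightarrow> 'm"
  Comp :: "'m \<Rightarrow> 'm \<Rightarrow> 'm"  (infixr "\<cdot>\<index>" 70)

definition hom :: "('o, 'm) cat \<Rightarrow> 'o \<Rightarrow> 'o \<Rightarrow> 'm set" where
  "hom C X Y = {f \<in> Arr C. Dom C f = X \<and> Cod C f = Y}"

locale category =
  fixes C :: "('o, 'm) cat" (structure)
  assumes Dom_in: "f \<in> Arr C \<Longrightarrow> Dom C f \<in> Obj C"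
    and Cod_in: "f \<in> Arr C \<Longrightarrow> Cod C f \<in> Obj C"
    and Id_in: "X \<in> Obj C \<Longrightarrow> Id C X \<in> hom C X X"
    and Comp_in: "\<lbrakk>f \<in> hom C X Y; g \<in> hom C Y Z\<rbrakk> \<Longrightarrow> g \<cdot> f \<in> hom C X Z"
    and Id_right: "f \<in> hom C X Y \<Longrightarrow> f \<cdot> Id C X = f"
    and Id_left: "f \<in> hom C X Y \<Longrightarrow> Id C Y \<cdot> f = f"
    and assoc: "\<lbrakk>f \<in> hom C W X; g \<in> hom C X Y; h \<in> hom C Y Z\<rbrakk>
                  \<Longrightarrow> (h \<cdot> g) \<cdot> f = h \<cdot> (g \<cdot> f)"

record ('o, 'm, 'p, 'n) fctr =
  omap :: "'o \<Rightarrow> 'p"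
  amap :: "'m \<Rightarrow> 'n"

text \<open>
  The object and arrow maps of a functor, and the family of components of a natural
  transformation, are required to be extensional (undefined outside their domain).  Hence
  equality in HOL of functors or of natural transformations is their equality as set-theoretic
  functions, and sets of functors or transformations contain no spurious duplicates.
\<close>

locale cat_functor = src: category C + tgt: category D
  for C :: "('o, 'm) cat" and D :: "('p, 'n) cat" +
  fixes F :: "('o, 'm, 'p, 'n) fctr"
  assumes omap_in: "omap F \<in> Obj C \<rightarrow>\<^sub>E Obj D"
    and amap_in: "amap F \<in> Arr C \<rightarrow>\<^sub>E Arr D"
    and amap_hom: "f \<in> hom C X Y \<Longrightarrow> amap F f \<in> hom D (omap F X) (omap F Y)"
    and amap_Id: "X \<in> Obj C \<Longrightarrow> amap F (Id C X) = Id D (omap F X)"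
    and amap_Comp: "\<lbrakk>f \<in> hom C X Y; g \<in> hom C Y Z\<rbrakk>
                      \<Longrightarrow> amap F (g \<cdot>\<^bsub>C\<^esub> f) = amap F g \<cdot>\<^bsub>D\<^esub> amap F f"

definition id_fctr :: "('o, 'm) cat \<Rightarrow> ('o, 'm, 'o, 'm) fctr" where
  "id_fctr C = \<lparr>omap = (\<lambda>X\<in>Obj C. X), amap = (\<lambda>f\<in>Arr C. f)\<rparr>"

text \<open>The first argument of \<open>comp_fctr\<close> is the source category of the inner functor.\<close>

definition comp_fctr ::
  "('o, 'm) cat \<Rightarrow> ('p, 'n, 'q, 'k) fctr \<Rightarrow> ('o, 'm, 'p, 'n) fctr \<Rightarrow> ('o, 'm, 'q, 'k) fctr" where
  "comp_fctr C G F =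
     \<lparr>omap = (\<lambda>X\<in>Obj C. omap G (omap F X)), amap = (\<lambda>f\<in>Arr C. amap G (amap F f))\<rparr>"

locale nat_trans = src: cat_functor C D F + tgt: cat_functor C D G
  for C :: "('o, 'm) cat" and D :: "('p, 'n) cat"
    and F :: "('o, 'm, 'p, 'n) fctr" and G :: "('o, 'm, 'p, 'n) fctr" +
  fixes \<tau> :: "'o \<Rightarrow> 'n"
  assumes ext: "\<tau> \<in> extensional (Obj C)"
    and component: "X \<in> Obj C \<Longrightarrow> \<tau> X \<in> hom D (omap F X) (omap G X)"
    and natural: "f \<in> hom C X Y \<Longrightarrow> amap G f \<cdot>\<^bsub>D\<^esub> \<tau> X = \<tau> Y \<cdot>\<^bsub>D\<^esub> amap F f"


section \<open>Adjunctions and comonads\<close>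

text \<open>\<open>adjunction B A L R \<eta> e\<close>: the functor \<open>L : B \<rightarrow> A\<close> is left adjoint to
  \<open>R : A \<rightarrow> B\<close> with unit \<open>\<eta>\<close> and counit \<open>e\<close>.\<close>

locale adjunction =
    left: cat_functor B A L + right: cat_functor A B R +
    unit: nat_trans B B "id_fctr B" "comp_fctr B R L" \<eta> +
    counit: nat_trans A A "comp_fctr A L R" "id_fctr A" e
  for B :: "('p, 'n) cat" and A :: "('o, 'm) cat"
    and L :: "('p, 'n, 'o, 'm) fctr" and R :: "('o, 'm, 'p, 'n) fctr"
    and \<eta> :: "'p \<Rightarrow> 'n" and e :: "'o \<Rightarrow> 'm" +
  assumes triangle_L: "Y \<in> Obj B \<Longrightarrow> e (omap L Y) \<cdot>\<^bsub>A\<^esub> amap L (\<eta> Y) = Id A (omap L Y)"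
    and triangle_R: "X \<in> Obj A \<Longrightarrow> amap R (e X) \<cdot>\<^bsub>B\<^esub> \<eta> (omap R X) = Id B (omap R X)"

locale comonad =
    endo: cat_functor A A G +
    comult: nat_trans A A G "comp_fctr A G G" \<Delta> +
    counit: nat_trans A A G "id_fctr A" \<epsilon>
  for A :: "('o, 'm) cat" and G :: "('o, 'm, 'o, 'm) fctr"
    and \<Delta> :: "'o \<Rightarrow> 'm" and \<epsilon> :: "'o \<Rightarrow> 'm" +
  assumes coassoc: "X \<in> Obj A \<Longrightarrow> amap G (\<Delta> X) \<cdot>\<^bsub>A\<^esub> \<Delta> X = \<Delta> (omap G X) \<cdot>\<^bsub>A\<^esub> \<Delta> X"
    and counit_left: "X \<in> Obj A \<Longrightarrow> \<epsilon> (omap G X) \<cdot>\<^bsub>A\<^esub> \<Delta> X = Id A (omap G X)"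
    and counit_right: "X \<in> Obj A \<Longrightarrow> amap G (\<epsilon> X) \<cdot>\<^bsub>A\<^esub> \<Delta> X = Id A (omap G X)"

text \<open>The first equation uses the form \<open>\<phi>G \<circ> H\<phi>\<close> of the horizontal square of \<open>\<phi>\<close>.\<close>

locale comonad_morphism =
    src: comonad A H \<delta> e + tgt: comonad A G \<Delta> \<epsilon> + nat_trans A A H G \<phi>
  for A :: "('o, 'm) cat"
    and H :: "('o, 'm, 'o, 'm) fctr" and \<delta> :: "'o \<Rightarrow> 'm" and e :: "'o \<Rightarrow> 'm"
    and G :: "('o, 'm, 'o, 'm) fctr" and \<Delta> :: "'o \<Rightarrow> 'm" and \<epsilon> :: "'o \<Rightarrow> 'm"
    and \<phi> :: "'o \<Rightarrow> 'm" +
  assumes comult_compat: "X \<in> Obj A \<Longrightarrow>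
      \<Delta> X \<cdot>\<^bsub>A\<^esub> \<phi> X = (\<phi> (omap G X) \<cdot>\<^bsub>A\<^esub> amap H (\<phi> X)) \<cdot>\<^bsub>A\<^esub> \<delta> X"
    and counit_compat: "X \<in> Obj A \<Longrightarrow> \<epsilon> X \<cdot>\<^bsub>A\<^esub> \<phi> X = e X"

definition adj_comult ::
  "('o, 'm) cat \<Rightarrow> ('p, 'n, 'o, 'm) fctr \<Rightarrow> ('o, 'm, 'p, 'n) fctr \<Rightarrow> ('p \<Rightarrow> 'n) \<Rightarrow> 'o \<Rightarrow> 'm" where
  "adj_comult A L R \<eta> = (\<lambda>X\<in>Obj A. amap L (\<eta> (omap R X)))"


section \<open>Coalgebras over a comonad\<close>

definition coalgebra ::
  "('o, 'm) cat \<Rightarrow> ('o, 'm, 'o, 'm) fctr \<Rightarrow> ('o \<Rightarrow> 'm) \<Rightarrow> ('o \<Rightarrow> 'm) \<Rightarrow> 'o \<Rightarrow> 'm \<Rightarrow> bool" where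
  "coalgebra A G \<Delta> \<epsilon> X x \<longleftrightarrow>
     X \<in> Obj A \<and> x \<in> hom A X (omap G X) \<and>
     amap G x \<cdot>\<^bsub>A\<^esub> x = \<Delta> X \<cdot>\<^bsub>A\<^esub> x \<and> \<epsilon> X \<cdot>\<^bsub>A\<^esub> x = Id A X"

definition coalgebra_morphism ::
  "('o, 'm) cat \<Rightarrow> ('o, 'm, 'o, 'm) fctr \<Rightarrow> 'o \<times> 'm \<Rightarrow> 'm \<Rightarrow> 'o \<times> 'm \<Rightarrow> bool" where
  "coalgebra_morphism A G P f Q \<longleftrightarrow>
     f \<in> hom A (fst P) (fst Q) \<and> amap G f \<cdot>\<^bsub>A\<^esub> snd P = snd Q \<cdot>\<^bsub>A\<^esub> f"

text \<open>
  One arrow \<open>f\<close> of \<open>A\<close> may be a morphism between several pairs of coalgebras, so an arrow of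
  the category of coalgebras is the triple \<open>(P, f, Q)\<close> recording its domain and codomain.
\<close>

definition coalg_cat ::
  "('o, 'm) cat \<Rightarrow> ('o, 'm, 'o, 'm) fctr \<Rightarrow> ('o \<Rightarrow> 'm) \<Rightarrow> ('o \<Rightarrow> 'm)
     \<Rightarrow> ('o \<times> 'm, ('o \<times> 'm) \<times> 'm \<times> ('o \<times> 'm)) cat" where
  "coalg_cat A G \<Delta> \<epsilon> =
     \<lparr>Obj = {(X, x). coalgebra A G \<Delta> \<epsilon> X x},
      Arr = {(P, f, Q). coalgebra A G \<Delta> \<epsilon> (fst P) (snd P) \<and> coalgebra A G \<Delta> \<epsilon> (fst Q) (snd Q)
                        \<and> coalgebra_morphism A G P f Q},
      Dom = (\<lambda>(P, f, Q). P),
      Cod = (\<lambda>(P, f, Q). Q),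
      Id = (\<lambda>P. (P, Id A (fst P), P)),
      Comp = (\<lambda>(Q', g, R) (P, f, Q). (P, g \<cdot>\<^bsub>A\<^esub> f, R))\<rparr>"

definition forgetful ::
  "('o, 'm) cat \<Rightarrow> ('o, 'm, 'o, 'm) fctr \<Rightarrow> ('o \<Rightarrow> 'm) \<Rightarrow> ('o \<Rightarrow> 'm)
     \<Rightarrow> ('o \<times> 'm, ('o \<times> 'm) \<times> 'm \<times> ('o \<times> 'm), 'o, 'm) fctr" where
  "forgetful A G \<Delta> \<epsilon> =
     \<lparr>omap = (\<lambda>(X, x)\<in>Obj (coalg_cat A G \<Delta> \<epsilon>). X),
      amap = (\<lambda>(P, f, Q)\<in>Arr (coalg_cat A G \<Delta> \<epsilon>). f)\<rparr>"

section \<open>Well-definedness\<close>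

lemma comp_fctr_functor:
  assumes "cat_functor C D F" "cat_functor D E G"
  shows "cat_functor C E (comp_fctr C G F)"
proof -
  interpret F: cat_functor C D F by fact
  interpret G: cat_functor D E G by fact
  have o: "X \<in> Obj C \<and> Y \<in> Obj C \<and> f \<in> Arr C" if "f \<in> hom C X Y" for f X Y
    using that F.src.Dom_in F.src.Cod_in by (auto simp: hom_def)
  show ?thesis
  proof (unfold_locales, goal_cases)
    case 1 show ?case using F.omap_in G.omap_in by (auto simp: comp_fctr_def)
  next
    case 2 show ?case using F.amap_in G.amap_in by (auto simp: comp_fctr_def)
  next
    case (3 f X Y)
    then show ?case using o[OF 3] by (simp add: comp_fctr_def F.amap_hom G.amap_hom)
  next
    case (4 X)
    then have "omap F X \<in> Obj D" using F.omap_in by auto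
    with 4 show ?case using o[OF F.src.Id_in[OF 4]]
      by (simp add: comp_fctr_def F.amap_Id G.amap_Id)
  next
    case (5 f X Y g Z)
    then show ?case using o[OF F.src.Comp_in[OF 5]] o[OF 5(1)] o[OF 5(2)]
      by (simp add: comp_fctr_def F.amap_Comp G.amap_Comp[OF F.amap_hom F.amap_hom])
  qed
qed

lemma coalg_cat_Obj: "P \<in> Obj (coalg_cat A G \<Delta> \<epsilon>) \<longleftrightarrow> coalgebra A G \<Delta> \<epsilon> (fst P) (snd P)"
  by (cases P) (simp add: coalg_cat_def)

lemma coalg_cat_hom:
  "F \<in> hom (coalg_cat A G \<Delta> \<epsilon>) P Q \<longleftrightarrow>
     (\<exists>f. F = (P, f, Q) \<and> coalgebra A G \<Delta> \<epsilon> (fst P) (snd P) \<and> coalgebra A G \<Delta> \<epsilon> (fst Q) (snd Q)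
          \<and> coalgebra_morphism A G P f Q)"
  by (cases F) (auto simp: coalg_cat_def hom_def)

lemma coalg_cat_Comp: "(Q', g, R) \<cdot>\<^bsub>coalg_cat A G \<Delta> \<epsilon>\<^esub> (P, f, Q) = (P, g \<cdot>\<^bsub>A\<^esub> f, R)"
  by (simp add: coalg_cat_def)

lemma coalg_cat_category:
  assumes "comonad A G \<Delta> \<epsilon>"
  shows "category (coalg_cat A G \<Delta> \<epsilon>)"
proof -
  interpret comonad A G \<Delta> \<epsilon> by fact
  have C: "coalgebra_morphism A G P (g \<cdot>\<^bsub>A\<^esub> f) R"
    if f: "coalgebra_morphism A G P f Q" and g: "coalgebra_morphism A G Q g R"
      and c: "coalgebra A G \<Delta> \<epsilon> (fst P) (snd P)" "coalgebra A G \<Delta> \<epsilon> (fst Q) (snd Q)"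
        "coalgebra A G \<Delta> \<epsilon> (fst R) (snd R)" for P f Q g R
  proof -
    have h: "f \<in> hom A (fst P) (fst Q)" "g \<in> hom A (fst Q) (fst R)"
      and x: "snd P \<in> hom A (fst P) (omap G (fst P))" "snd Q \<in> hom A (fst Q) (omap G (fst Q))"
        "snd R \<in> hom A (fst R) (omap G (fst R))"
      and eq: "amap G f \<cdot>\<^bsub>A\<^esub> snd P = snd Q \<cdot>\<^bsub>A\<^esub> f" "amap G g \<cdot>\<^bsub>A\<^esub> snd Q = snd R \<cdot>\<^bsub>A\<^esub> g"
      using f g c by (auto simp: coalgebra_morphism_def coalgebra_def)
    note Gh = h[THEN endo.amap_hom]
    have "amap G (g \<cdot>\<^bsub>A\<^esub> f) \<cdot>\<^bsub>A\<^esub> snd P = amap G g \<cdot>\<^bsub>A\<^esub> (snd Q \<cdot>\<^bsub>A\<^esub> f)"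
      by (simp add: endo.amap_Comp[OF h] endo.src.assoc[OF x(1) Gh] eq)
    also have "\<dots> = snd R \<cdot>\<^bsub>A\<^esub> (g \<cdot>\<^bsub>A\<^esub> f)"
      by (simp add: endo.src.assoc[OF h(1) x(2) Gh(2), symmetric] eq endo.src.assoc[OF h x(3)])
    finally show ?thesis
      using endo.src.Comp_in[OF h] by (simp add: coalgebra_morphism_def)
  qed
  show ?thesis
  proof (unfold_locales, goal_cases)
    case (1 F) then show ?case by (auto simp: coalg_cat_def)
  next
    case (2 F) then show ?case by (auto simp: coalg_cat_def)
  next
    case (3 P)
    then have "fst P \<in> Obj A" "snd P \<in> hom A (fst P) (omap G (fst P))"
      by (auto simp: coalg_cat_Obj coalgebra_def)
    then have "coalgebra_morphism A G P (Id A (fst P)) P"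
      using endo.src.Id_left endo.src.Id_right
      by (auto simp: coalgebra_morphism_def endo.src.Id_in endo.amap_Id)
    with 3 show ?case by (simp add: coalg_cat_hom coalg_cat_Obj) (simp add: coalg_cat_def)
  next
    case (4 F P Q F' R)
    then show ?case by (auto simp: coalg_cat_hom coalg_cat_Comp intro: C)
  next
    case (5 F P Q)
    then show ?case unfolding coalg_cat_hom
      by (auto simp: coalg_cat_def coalgebra_morphism_def endo.src.Id_right)
  next
    case (6 F P Q)
    then show ?case unfolding coalg_cat_hom
      by (auto simp: coalg_cat_def coalgebra_morphism_def endo.src.Id_left)
  next
    case (7 F P Q F' R F'' S)
    then show ?case
      by (auto simp: coalg_cat_hom coalg_cat_Comp coalgebra_morphism_def endo.src.assoc)
  qed
qed

lemma forgetful_functor: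
  assumes "comonad A G \<Delta> \<epsilon>"
  shows "cat_functor (coalg_cat A G \<Delta> \<epsilon>) A (forgetful A G \<Delta> \<epsilon>)"
proof -
  interpret comonad A G \<Delta> \<epsilon> by fact
  interpret K: category "coalg_cat A G \<Delta> \<epsilon>" using assms by (rule coalg_cat_category)
  have o: "P \<in> Obj (coalg_cat A G \<Delta> \<epsilon>) \<and> Q \<in> Obj (coalg_cat A G \<Delta> \<epsilon>) \<and> F \<in> Arr (coalg_cat A G \<Delta> \<epsilon>)"
    if "F \<in> hom (coalg_cat A G \<Delta> \<epsilon>) P Q" for F P Q
    using that K.Dom_in[of F] K.Cod_in[of F] by (simp add: hom_def)
  show ?thesis
  proof (unfold_locales, goal_cases)
    case 1 show ?case by (auto simp: forgetful_def coalg_cat_Obj coalgebra_def)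
  next
    case 2 show ?case
      by (auto simp: forgetful_def coalg_cat_def coalgebra_morphism_def hom_def)
  next
    case (3 F P Q)
    with o[OF 3] show ?case
      by (auto simp: forgetful_def coalg_cat_hom coalgebra_morphism_def split: prod.splits)
  next
    case (4 P)
    with o[OF K.Id_in[OF 4]] have "Id (coalg_cat A G \<Delta> \<epsilon>) P \<in> Arr (coalg_cat A G \<Delta> \<epsilon>)" by blast
    moreover have "Id (coalg_cat A G \<Delta> \<epsilon>) P = (P, Id A (fst P), P)" by (simp add: coalg_cat_def)
    ultimately show ?case using 4 by (simp add: forgetful_def split: prod.splits)
  next
    case (5 F P Q F' R)
    with o[OF K.Comp_in[OF 5]] o[OF 5(1)] o[OF 5(2)] show ?case
      by (auto simp: forgetful_def coalg_cat_hom coalg_cat_Comp)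
  qed
qed

lemma adjunction_comonad:
  assumes "adjunction B A L R \<eta> e"
  shows "comonad A (comp_fctr A L R) (adj_comult A L R \<eta>) e"
proof -
  interpret adjunction B A L R \<eta> e by fact
  note LR = counit.src.cat_functor_axioms
  note LRLR = comp_fctr_functor[OF LR LR]
  note c = comp_fctr_def adj_comult_def id_fctr_def
  have RO: "omap R X \<in> Obj B" if "X \<in> Obj A" for X using that right.omap_in by auto
  have LO: "omap L X \<in> Obj A" if "X \<in> Obj B" for X using that left.omap_in by auto
  have hO: "X \<in> Obj A \<and> Y \<in> Obj A \<and> f \<in> Arr A" if "f \<in> hom A X Y" for f X Y
    using that left.tgt.Dom_in left.tgt.Cod_in by (auto simp: hom_def)
  have hOB: "X \<in> Obj B \<and> Y \<in> Obj B \<and> f \<in> Arr B" if "f \<in> hom B X Y" for f X Y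
    using that left.src.Dom_in left.src.Cod_in by (auto simp: hom_def)
  have uh: "\<eta> X \<in> hom B X (omap R (omap L X))" if "X \<in> Obj B" for X
    using unit.component[OF that] that by (simp add: c)
  have eh: "e X \<in> hom A (omap L (omap R X)) X" if "X \<in> Obj A" for X
    using counit.component[OF that] that by (simp add: c)
  have un: "amap R (amap L f) \<cdot>\<^bsub>B\<^esub> \<eta> X = \<eta> Y \<cdot>\<^bsub>B\<^esub> f" if "f \<in> hom B X Y" for f X Y
    using unit.natural[OF that] hOB[OF that] by (simp add: c)
  have dn: "amap L (amap R (amap L f)) \<cdot>\<^bsub>A\<^esub> amap L (\<eta> X) = amap L (\<eta> Y) \<cdot>\<^bsub>A\<^esub> amap L f"
    if f: "f \<in> hom B X Y" for f X Y
  proof -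
    have X: "X \<in> Obj B" and Y: "Y \<in> Obj B" using hOB[OF f] by auto
    have "amap L (amap R (amap L f)) \<cdot>\<^bsub>A\<^esub> amap L (\<eta> X) = amap L (amap R (amap L f) \<cdot>\<^bsub>B\<^esub> \<eta> X)"
      by (rule left.amap_Comp[symmetric, OF uh[OF X] right.amap_hom[OF left.amap_hom[OF f]]])
    also have "\<dots> = amap L (\<eta> Y) \<cdot>\<^bsub>A\<^esub> amap L f"
      unfolding un[OF f] by (rule left.amap_Comp[OF f uh[OF Y]])
    finally show ?thesis .
  qed
  have dh: "amap L (\<eta> Y) \<in> hom A (omap L Y) (omap L (omap R (omap L Y)))" if "Y \<in> Obj B" for Y
    by (rule left.amap_hom[OF uh[OF that]])
  have "nat_trans A A (comp_fctr A L R)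
          (comp_fctr A (comp_fctr A L R) (comp_fctr A L R)) (adj_comult A L R \<eta>)"
  proof (intro nat_trans.intro LR LRLR nat_trans_axioms.intro, goal_cases)
    case 1 show ?case by (simp add: c)
  next
    case (2 X) then show ?case using dh[OF RO[OF 2]] by (simp add: c RO LO)
  next
    case (3 f X Y)
    have "amap L (amap R f) \<in> Arr A"
      using hO[OF left.amap_hom[OF right.amap_hom[OF 3]]] by blast
    then show ?case using dn[OF right.amap_hom[OF 3]] hO[OF 3] by (simp add: c)
  qed
  then show ?thesis
  proof (intro comonad.intro LR counit.nat_trans_axioms comonad_axioms.intro, goal_cases)
    case (2 X)
    have "amap L (\<eta> (omap R X)) \<in> Arr A" using hO[OF dh[OF RO[OF 2(2)]]] by blast
    then show ?case using dn[OF uh[OF RO[OF 2(2)]]] 2(2) by (simp add: c RO LO)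
  next
    case (3 X)
    then show ?case using triangle_L[OF RO[OF 3(2)]] by (simp add: c RO LO)
  next
    case (4 X)
    have "amap L (amap R (e X)) \<cdot>\<^bsub>A\<^esub> amap L (\<eta> (omap R X)) = amap L (amap R (e X) \<cdot>\<^bsub>B\<^esub> \<eta> (omap R X))"
      by (rule left.amap_Comp[symmetric, OF uh[OF RO[OF 4(2)]] right.amap_hom[OF eh[OF 4(2)]]])
    also have "\<dots> = Id A (omap L (omap R X))"
      using triangle_R[OF 4(2)] by (simp add: left.amap_Id RO 4(2))
    finally show ?case using 4(2) hO[OF eh[OF 4(2)]] by (simp add: c)
  qed
qed

end

theory Submission
  imports Defs
begin

text \<open>
  A functor \<open>K\<close> with \<open>UK = L\<close> amounts to a coaction of \<open>G\<close> on \<open>L\<close>: a natural transformation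
  \<open>k : L \<rightarrow> GL\<close> whose components are coalgebra structures on the objects \<open>L Y\<close>
  (\<open>bij_betw_lifts_coactions\<close>).

  Because \<open>L\<close> is left adjoint to \<open>R\<close>, natural transformations \<open>k : L \<rightarrow> GL\<close> correspond to natural transformations
  \<open>\<phi> : LR \<rightarrow> G\<close>, their mates: \<open>\<phi> X = G(e X) \<circ> k(R X)\<close> and \<open>k Y = \<phi>(L Y) \<circ> L(\<eta> Y)\<close>, which are
  mutually inverse by naturality and the triangle identities.  Under this correspondence the two
  coalgebra axioms for \<open>k\<close> become the two axioms of a comonad morphism for \<open>\<phi>\<close>
  (\<open>comonad_mor_of_coaction\<close> and \<open>coaction_of_comonad_mor\<close>).  For the coassociativity axioms the
  decisive observation is that \<open>G(k Y) \<circ> k Y\<close>, with the right-hand \<open>k Y\<close> replaced by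
  \<open>\<phi>(L Y) \<circ> L(\<eta> Y)\<close>, is turned by naturality of \<open>\<phi>\<close> at \<open>k Y\<close> into an expression that involves
  the horizontal square of \<open>\<phi>\<close> and the comultiplication \<open>L\<eta>R\<close>.
\<close>

section \<open>Composable arrows\<close>

context category
begin

lemma hom_Dom_Cod: "f \<in> Arr C \<Longrightarrow> f \<in> hom C (Dom C f) (Cod C f)"
  by (simp add: hom_def)

lemma
  assumes "f \<in> Arr C" "g \<in> Arr C" "Cod C f = Dom C g"
  shows Comp_Arr: "g \<cdot> f \<in> Arr C"
    and Dom_Comp: "Dom C (g \<cdot> f) = Dom C f"
    and Cod_Comp: "Cod C (g \<cdot> f) = Cod C g"
  using Comp_in[of f "Dom C f" "Cod C f" g "Cod C g"] assms by (simp_all add: hom_def)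

lemma
  assumes "X \<in> Obj C"
  shows Id_Arr: "Id C X \<in> Arr C" and Dom_Id: "Dom C (Id C X) = X" and Cod_Id: "Cod C (Id C X) = X"
  using Id_in[OF assms] by (simp_all add: hom_def)

lemma Comp_Id: "f \<in> Arr C \<Longrightarrow> Dom C f = X \<Longrightarrow> f \<cdot> Id C X = f"
  using Id_right[of f X "Cod C f"] by (simp add: hom_def)

lemma Id_Comp: "f \<in> Arr C \<Longrightarrow> Cod C f = Y \<Longrightarrow> Id C Y \<cdot> f = f"
  using Id_left[of f "Dom C f" Y] by (simp add: hom_def)

lemma Comp_assoc:
  assumes "f \<in> Arr C" "g \<in> Arr C" "h \<in> Arr C" "Cod C f = Dom C g" "Cod C g = Dom C h"
  shows "(h \<cdot> g) \<cdot> f = h \<cdot> (g \<cdot> f)"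
  using assoc[of f "Dom C f" "Cod C f" g "Cod C g" h "Cod C h"] assms by (simp add: hom_def)

text \<open>
  Stated with \<open>Dom\<close> and \<open>Cod\<close>, the side conditions contain no variables beyond those of the
  conclusion, so that the simplifier can discharge them while it normalises composites.
\<close>

lemmas category_simps =
  Dom_in Cod_in Comp_Arr Dom_Comp Cod_Comp Id_Arr Dom_Id Cod_Id Comp_Id Id_Comp Comp_assoc

end

context cat_functor
begin

lemma omap_Obj: "X \<in> Obj C \<Longrightarrow> omap F X \<in> Obj D"
  using omap_in by auto

lemma
  assumes "f \<in> Arr C"
  shows amap_Arr: "amap F f \<in> Arr D"
    and Dom_amap: "Dom D (amap F f) = omap F (Dom C f)"
    and Cod_amap: "Cod D (amap F f) = omap F (Cod C f)"
  using amap_hom[OF src.hom_Dom_Cod[OF assms]] by (simp_all add: hom_def)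

lemma amap_Comp_Arr:
  assumes "f \<in> Arr C" "g \<in> Arr C" "Cod C f = Dom C g"
  shows "amap F (g \<cdot>\<^bsub>C\<^esub> f) = amap F g \<cdot>\<^bsub>D\<^esub> amap F f"
  using amap_Comp[of f "Dom C f" "Cod C f" g "Cod C g"] assms by (simp add: hom_def)

lemmas functor_simps = omap_Obj amap_Arr Dom_amap Cod_amap amap_Id amap_Comp_Arr

end

section \<open>Lifts of a functor to coalgebras\<close>

text \<open>
  A natural transformation \<open>k : L \<rightarrow> GL\<close> that is a \<open>G\<close>-coalgebra structure on every \<open>L Y\<close>.
  Naturality of \<open>k\<close> is expressed by every \<open>L f\<close> being a coalgebra morphism.
\<close>

definition coaction ::
  "('p, 'n) cat \<Rightarrow> ('o, 'm) cat \<Rightarrow> ('o, 'm, 'o, 'm) fctr \<Rightarrow> ('o \<Rightarrow> 'm) \<Rightarrow> ('o \<Rightarrow> 'm)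
     \<Rightarrow> ('p, 'n, 'o, 'm) fctr \<Rightarrow> ('p \<Rightarrow> 'm) \<Rightarrow> bool" where
  "coaction B A G \<Delta> \<epsilon> L k \<longleftrightarrow>
     k \<in> extensional (Obj B) \<and>
     (\<forall>Y\<in>Obj B. coalgebra A G \<Delta> \<epsilon> (omap L Y) (k Y)) \<and>
     (\<forall>f\<in>Arr B. coalgebra_morphism A G
        (omap L (Dom B f), k (Dom B f)) (amap L f) (omap L (Cod B f), k (Cod B f)))"

definition lift_of_coaction ::
  "('p, 'n) cat \<Rightarrow> ('p, 'n, 'o, 'm) fctr \<Rightarrow> ('p \<Rightarrow> 'm)
     \<Rightarrow> ('p, 'n, 'o \<times> 'm, ('o \<times> 'm) \<times> 'm \<times> ('o \<times> 'm)) fctr" where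
  "lift_of_coaction B L k =
     \<lparr>omap = (\<lambda>Y\<in>Obj B. (omap L Y, k Y)),
      amap = (\<lambda>f\<in>Arr B. ((omap L (Dom B f), k (Dom B f)), amap L f, (omap L (Cod B f), k (Cod B f))))\<rparr>"

lemma coalg_cat_Arr:
  "(P, f, Q) \<in> Arr (coalg_cat A G \<Delta> \<epsilon>) \<longleftrightarrow>
     coalgebra A G \<Delta> \<epsilon> (fst P) (snd P) \<and> coalgebra A G \<Delta> \<epsilon> (fst Q) (snd Q)
     \<and> coalgebra_morphism A G P f Q"
  by (simp add: coalg_cat_def)

lemma omap_forgetful: "P \<in> Obj (coalg_cat A G \<Delta> \<epsilon>) \<Longrightarrow> omap (forgetful A G \<Delta> \<epsilon>) P = fst P"
  by (simp add: forgetful_def split: prod.splits)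

lemma amap_forgetful:
  "(P, f, Q) \<in> Arr (coalg_cat A G \<Delta> \<epsilon>) \<Longrightarrow> amap (forgetful A G \<Delta> \<epsilon>) (P, f, Q) = f"
  by (simp add: forgetful_def)

lemma
  assumes K: "cat_functor B (coalg_cat A G \<Delta> \<epsilon>) K"
    and UK: "comp_fctr B (forgetful A G \<Delta> \<epsilon>) K = L"
  shows omap_lift: "Y \<in> Obj B \<Longrightarrow> omap K Y = (omap L Y, snd (omap K Y))"
    and amap_lift: "f \<in> Arr B \<Longrightarrow> amap K f = (omap K (Dom B f), amap L f, omap K (Cod B f))"
proof -
  interpret K: cat_functor B "coalg_cat A G \<Delta> \<epsilon>" K by fact
  show "omap K Y = (omap L Y, snd (omap K Y))" if "Y \<in> Obj B"
    using that K.omap_Obj[OF that]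
    by (simp add: UK[symmetric] comp_fctr_def omap_forgetful)
  show "amap K f = (omap K (Dom B f), amap L f, omap K (Cod B f))" if f: "f \<in> Arr B"
  proof -
    obtain g where g: "amap K f = (omap K (Dom B f), g, omap K (Cod B f))"
      using K.amap_hom[OF K.src.hom_Dom_Cod[OF f]] unfolding coalg_cat_hom by blast
    then have "amap L f = g"
      using f K.amap_Arr[OF f] by (simp add: UK[symmetric] comp_fctr_def amap_forgetful)
    with g show ?thesis by simp
  qed
qed

lemma coaction_of_lift:
  assumes K: "cat_functor B (coalg_cat A G \<Delta> \<epsilon>) K"
    and UK: "comp_fctr B (forgetful A G \<Delta> \<epsilon>) K = L"
  shows "coaction B A G \<Delta> \<epsilon> L (\<lambda>Y\<in>Obj B. snd (omap K Y))"
proof -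
  interpret K: cat_functor B "coalg_cat A G \<Delta> \<epsilon>" K by fact
  note o = omap_lift[OF K UK, symmetric]
  have "coalgebra A G \<Delta> \<epsilon> (omap L Y) (snd (omap K Y))" if "Y \<in> Obj B" for Y
    using K.omap_Obj[OF that] arg_cong[OF o[OF that], of fst]
    by (simp add: coalg_cat_Obj)
  moreover have "coalgebra_morphism A G
      (omap L (Dom B f), snd (omap K (Dom B f))) (amap L f) (omap L (Cod B f), snd (omap K (Cod B f)))"
    if "f \<in> Arr B" for f
    using K.amap_Arr[OF that] that
    by (simp add: amap_lift[OF K UK] coalg_cat_Arr o K.src.Dom_in K.src.Cod_in)
  ultimately show ?thesis
    by (simp add: coaction_def K.src.Dom_in K.src.Cod_in)
qed

lemma lift_of_coaction_functor:
  assumes G: "comonad A G \<Delta> \<epsilon>" and L: "cat_functor B A L" and k: "coaction B A G \<Delta> \<epsilon> L k"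
  shows "cat_functor B (coalg_cat A G \<Delta> \<epsilon>) (lift_of_coaction B L k)"
proof -
  interpret L: cat_functor B A L by fact
  interpret E: category "coalg_cat A G \<Delta> \<epsilon>" using G by (rule coalg_cat_category)
  have ob: "coalgebra A G \<Delta> \<epsilon> (omap L Y) (k Y)" if "Y \<in> Obj B" for Y
    using k that by (simp add: coaction_def)
  have mor: "coalgebra_morphism A G
      (omap L (Dom B f), k (Dom B f)) (amap L f) (omap L (Cod B f), k (Cod B f))"
    if "f \<in> Arr B" for f
    using k that by (simp add: coaction_def)
  show ?thesis
  proof (unfold_locales, goal_cases)
    case 1 show ?case by (simp add: lift_of_coaction_def coalg_cat_Obj ob)
  next
    case 2 show ?case
      by (auto simp: lift_of_coaction_def coalg_cat_Arr L.src.Dom_in L.src.Cod_in ob mor)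
  next
    case (3 f X Y)
    then have "f \<in> Arr B" "Dom B f = X" "Cod B f = Y" "X \<in> Obj B" "Y \<in> Obj B"
      using L.src.Dom_in L.src.Cod_in by (auto simp: hom_def)
    then show ?case using mor[of f]
      by (simp add: coalg_cat_hom lift_of_coaction_def ob)
  next
    case (4 X)
    then show ?case
      by (simp add: lift_of_coaction_def L.src.category_simps L.functor_simps coalg_cat_def)
  next
    case (5 f X Y g Z)
    then show ?case
      by (simp add: hom_def lift_of_coaction_def L.src.category_simps L.functor_simps coalg_cat_Comp)
  qed
qed

lemma forgetful_lift_of_coaction:
  assumes L: "cat_functor B A L" and k: "coaction B A G \<Delta> \<epsilon> L k"
  shows "comp_fctr B (forgetful A G \<Delta> \<epsilon>) (lift_of_coaction B L k) = L"
proof -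
  interpret L: cat_functor B A L by fact
  have "omap (comp_fctr B (forgetful A G \<Delta> \<epsilon>) (lift_of_coaction B L k)) = omap L"
    using k L.omap_in
    by (intro extensionalityI[of _ "Obj B"])
      (auto simp: comp_fctr_def lift_of_coaction_def coaction_def omap_forgetful coalg_cat_Obj
        simp: PiE_def)
  moreover have "amap (comp_fctr B (forgetful A G \<Delta> \<epsilon>) (lift_of_coaction B L k)) = amap L"
    using k L.amap_in
    by (intro extensionalityI[of _ "Arr B"])
      (auto simp: comp_fctr_def lift_of_coaction_def coaction_def amap_forgetful coalg_cat_Arr
        L.src.Dom_in L.src.Cod_in simp: PiE_def)
  ultimately show ?thesis by simp
qed

text \<open>
  An equation \<open>UK = L\<close> determines the carriers \<open>L Y\<close> and the underlying arrows \<open>L f\<close>, so only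
  the coalgebra structures on the objects \<open>L Y\<close> are left to choose.
\<close>

lemma bij_betw_lifts_coactions:
  assumes G: "comonad A G \<Delta> \<epsilon>" and L: "cat_functor B A L"
  shows "bij_betw (\<lambda>K. \<lambda>Y\<in>Obj B. snd (omap K Y))
           {K. cat_functor B (coalg_cat A G \<Delta> \<epsilon>) K \<and> comp_fctr B (forgetful A G \<Delta> \<epsilon>) K = L}
           {k. coaction B A G \<Delta> \<epsilon> L k}"
proof (rule bij_betw_byWitness[where f' = "lift_of_coaction B L"])
  interpret L: cat_functor B A L by fact
  show "\<forall>K\<in>{K. cat_functor B (coalg_cat A G \<Delta> \<epsilon>) K \<and> comp_fctr B (forgetful A G \<Delta> \<epsilon>) K = L}.
          lift_of_coaction B L (\<lambda>Y\<in>Obj B. snd (omap K Y)) = K"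
  proof
    fix K assume "K \<in> {K. cat_functor B (coalg_cat A G \<Delta> \<epsilon>) K \<and> comp_fctr B (forgetful A G \<Delta> \<epsilon>) K = L}"
    then have K: "cat_functor B (coalg_cat A G \<Delta> \<epsilon>) K"
      and UK: "comp_fctr B (forgetful A G \<Delta> \<epsilon>) K = L" by auto
    interpret K: cat_functor B "coalg_cat A G \<Delta> \<epsilon>" K by fact
    note o = omap_lift[OF K UK, symmetric]
    have "omap (lift_of_coaction B L (\<lambda>Y\<in>Obj B. snd (omap K Y))) = omap K"
      using K.omap_in
      by (intro extensionalityI[of _ "Obj B"]) (auto simp: lift_of_coaction_def o PiE_def)
    moreover have "amap (lift_of_coaction B L (\<lambda>Y\<in>Obj B. snd (omap K Y))) = amap K"
      using K.amap_in
      by (intro extensionalityI[of _ "Arr B"])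
        (auto simp: lift_of_coaction_def o PiE_def amap_lift[OF K UK] L.src.Dom_in L.src.Cod_in)
    ultimately show "lift_of_coaction B L (\<lambda>Y\<in>Obj B. snd (omap K Y)) = K"
      by simp
  qed
  show "\<forall>k\<in>{k. coaction B A G \<Delta> \<epsilon> L k}.
          (\<lambda>Y\<in>Obj B. snd (omap (lift_of_coaction B L k) Y)) = k"
    by (auto simp: lift_of_coaction_def coaction_def extensional_def fun_eq_iff)
  show "(\<lambda>K. \<lambda>Y\<in>Obj B. snd (omap K Y)) `
      {K. cat_functor B (coalg_cat A G \<Delta> \<epsilon>) K \<and> comp_fctr B (forgetful A G \<Delta> \<epsilon>) K = L}
      \<subseteq> {k. coaction B A G \<Delta> \<epsilon> L k}"
    by (auto intro: coaction_of_lift)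
  show "lift_of_coaction B L ` {k. coaction B A G \<Delta> \<epsilon> L k}
      \<subseteq> {K. cat_functor B (coalg_cat A G \<Delta> \<epsilon>) K \<and> comp_fctr B (forgetful A G \<Delta> \<epsilon>) K = L}"
    using lift_of_coaction_functor[OF G L] forgetful_lift_of_coaction[OF L] by auto
qed

section \<open>Coactions and comonad morphisms\<close>

text \<open>
  The categories and functors are listed before the comonad and the adjunction, which imply them,
  so that their facts are available under short qualifiers.
\<close>

locale comonad_adjunction =
  A: category A + B: category B +
  G: cat_functor A A G + L: cat_functor B A L + R: cat_functor A B R +
  com: comonad A G \<Delta> \<epsilon> + adj: adjunction B A L R \<eta> e
  for A :: "('o, 'm) cat" and G :: "('o, 'm, 'o, 'm) fctr" and \<Delta> \<epsilon> :: "'o \<Rightarrow> 'm"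
    and B :: "('p, 'n) cat" and L :: "('p, 'n, 'o, 'm) fctr" and R :: "('o, 'm, 'p, 'n) fctr"
    and \<eta> :: "'p \<Rightarrow> 'n" and e :: "'o \<Rightarrow> 'm"
begin

lemmas simps = A.category_simps B.category_simps G.functor_simps L.functor_simps R.functor_simps

lemma unit_simps:
  assumes "Y \<in> Obj B"
  shows "\<eta> Y \<in> Arr B" "Dom B (\<eta> Y) = Y" "Cod B (\<eta> Y) = omap R (omap L Y)"
  using adj.unit.component[OF assms] assms by (simp_all add: hom_def id_fctr_def comp_fctr_def)

lemma transformation_simps:
  assumes "X \<in> Obj A"
  shows "e X \<in> Arr A" "Dom A (e X) = omap L (omap R X)" "Cod A (e X) = X"
    and "\<epsilon> X \<in> Arr A" "Dom A (\<epsilon> X) = omap G X" "Cod A (\<epsilon> X) = X"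
    and "\<Delta> X \<in> Arr A" "Dom A (\<Delta> X) = omap G X" "Cod A (\<Delta> X) = omap G (omap G X)"
  using adj.counit.component[OF assms] com.counit.component[OF assms] com.comult.component[OF assms]
    assms by (simp_all add: hom_def id_fctr_def comp_fctr_def)

lemma unit_natural:
  "g \<in> Arr B \<Longrightarrow> amap R (amap L g) \<cdot>\<^bsub>B\<^esub> \<eta> (Dom B g) = \<eta> (Cod B g) \<cdot>\<^bsub>B\<^esub> g"
  using adj.unit.natural[OF B.hom_Dom_Cod] by (simp add: id_fctr_def comp_fctr_def)

lemma
  assumes "f \<in> Arr A"
  shows counit_natural: "f \<cdot>\<^bsub>A\<^esub> e (Dom A f) = e (Cod A f) \<cdot>\<^bsub>A\<^esub> amap L (amap R f)"
    and comonad_counit_natural: "f \<cdot>\<^bsub>A\<^esub> \<epsilon> (Dom A f) = \<epsilon> (Cod A f) \<cdot>\<^bsub>A\<^esub> amap G f"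
    and comonad_comult_natural:
      "amap G (amap G f) \<cdot>\<^bsub>A\<^esub> \<Delta> (Dom A f) = \<Delta> (Cod A f) \<cdot>\<^bsub>A\<^esub> amap G f"
  using A.hom_Dom_Cod[OF assms, THEN adj.counit.natural]
    A.hom_Dom_Cod[OF assms, THEN com.counit.natural] A.hom_Dom_Cod[OF assms, THEN com.comult.natural]
    assms by (simp_all add: id_fctr_def comp_fctr_def)

lemma coactionD:
  assumes "coaction B A G \<Delta> \<epsilon> L k"
  shows "k \<in> extensional (Obj B)"
    and "Y \<in> Obj B \<Longrightarrow> k Y \<in> Arr A"
    and "Y \<in> Obj B \<Longrightarrow> Dom A (k Y) = omap L Y"
    and "Y \<in> Obj B \<Longrightarrow> Cod A (k Y) = omap G (omap L Y)"
    and "Y \<in> Obj B \<Longrightarrow> amap G (k Y) \<cdot>\<^bsub>A\<^esub> k Y = \<Delta> (omap L Y) \<cdot>\<^bsub>A\<^esub> k Y"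
    and "Y \<in> Obj B \<Longrightarrow> \<epsilon> (omap L Y) \<cdot>\<^bsub>A\<^esub> k Y = Id A (omap L Y)"
    and "g \<in> Arr B \<Longrightarrow> amap G (amap L g) \<cdot>\<^bsub>A\<^esub> k (Dom B g) = k (Cod B g) \<cdot>\<^bsub>A\<^esub> amap L g"
  using assms by (simp_all add: coaction_def coalgebra_def coalgebra_morphism_def hom_def)

lemma coactionI:
  assumes "k \<in> extensional (Obj B)"
    and "\<And>Y. Y \<in> Obj B \<Longrightarrow> k Y \<in> hom A (omap L Y) (omap G (omap L Y))"
    and "\<And>Y. Y \<in> Obj B \<Longrightarrow> amap G (k Y) \<cdot>\<^bsub>A\<^esub> k Y = \<Delta> (omap L Y) \<cdot>\<^bsub>A\<^esub> k Y"
    and "\<And>Y. Y \<in> Obj B \<Longrightarrow> \<epsilon> (omap L Y) \<cdot>\<^bsub>A\<^esub> k Y = Id A (omap L Y)"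
    and "\<And>g. g \<in> Arr B \<Longrightarrow>
           amap G (amap L g) \<cdot>\<^bsub>A\<^esub> k (Dom B g) = k (Cod B g) \<cdot>\<^bsub>A\<^esub> amap L g"
  shows "coaction B A G \<Delta> \<epsilon> L k"
  using assms L.amap_hom[OF B.hom_Dom_Cod]
  by (simp add: coaction_def coalgebra_def coalgebra_morphism_def simps)

abbreviation comonad_mor :: "('o \<Rightarrow> 'm) \<Rightarrow> bool" where
  "comonad_mor \<equiv> comonad_morphism A (comp_fctr A L R) (adj_comult A L R \<eta>) e G \<Delta> \<epsilon>"

lemma comonad_morD:
  assumes "comonad_mor \<phi>"
  shows "\<phi> \<in> extensional (Obj A)"
    and "X \<in> Obj A \<Longrightarrow> \<phi> X \<in> Arr A"
    and "X \<in> Obj A \<Longrightarrow> Dom A (\<phi> X) = omap L (omap R X)"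
    and "X \<in> Obj A \<Longrightarrow> Cod A (\<phi> X) = omap G X"
    and "f \<in> Arr A \<Longrightarrow>
           amap G f \<cdot>\<^bsub>A\<^esub> \<phi> (Dom A f) = \<phi> (Cod A f) \<cdot>\<^bsub>A\<^esub> amap L (amap R f)"
    and "X \<in> Obj A \<Longrightarrow> \<epsilon> X \<cdot>\<^bsub>A\<^esub> \<phi> X = e X"
    and "X \<in> Obj A \<Longrightarrow> \<Delta> X \<cdot>\<^bsub>A\<^esub> \<phi> X =
           (\<phi> (omap G X) \<cdot>\<^bsub>A\<^esub> amap L (amap R (\<phi> X))) \<cdot>\<^bsub>A\<^esub> amap L (\<eta> (omap R X))"
proof -
  interpret \<phi>: comonad_morphism A "comp_fctr A L R" "adj_comult A L R \<eta>" e G \<Delta> \<epsilon> \<phi> by fact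
  show "\<phi> \<in> extensional (Obj A)" by (rule \<phi>.ext)
  have c: "\<phi> X \<in> Arr A \<and> Dom A (\<phi> X) = omap L (omap R X) \<and> Cod A (\<phi> X) = omap G X"
    if "X \<in> Obj A" for X
    using \<phi>.component[OF that] that by (simp add: hom_def comp_fctr_def)
  then show "X \<in> Obj A \<Longrightarrow> \<phi> X \<in> Arr A" "X \<in> Obj A \<Longrightarrow> Dom A (\<phi> X) = omap L (omap R X)"
    "X \<in> Obj A \<Longrightarrow> Cod A (\<phi> X) = omap G X" by auto
  show "amap G f \<cdot>\<^bsub>A\<^esub> \<phi> (Dom A f) = \<phi> (Cod A f) \<cdot>\<^bsub>A\<^esub> amap L (amap R f)" if "f \<in> Arr A"
    using \<phi>.natural[OF A.hom_Dom_Cod[OF that]] that by (simp add: comp_fctr_def)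
  show "X \<in> Obj A \<Longrightarrow> \<epsilon> X \<cdot>\<^bsub>A\<^esub> \<phi> X = e X" by (rule \<phi>.counit_compat)
  show "\<Delta> X \<cdot>\<^bsub>A\<^esub> \<phi> X =
      (\<phi> (omap G X) \<cdot>\<^bsub>A\<^esub> amap L (amap R (\<phi> X))) \<cdot>\<^bsub>A\<^esub> amap L (\<eta> (omap R X))" if "X \<in> Obj A"
    using \<phi>.comult_compat[OF that] that c[OF that] by (simp add: comp_fctr_def adj_comult_def)
qed

lemma comonad_morI:
  assumes "\<phi> \<in> extensional (Obj A)"
    and h: "\<And>X. X \<in> Obj A \<Longrightarrow> \<phi> X \<in> hom A (omap L (omap R X)) (omap G X)"
    and n: "\<And>f. f \<in> Arr A \<Longrightarrow>
           amap G f \<cdot>\<^bsub>A\<^esub> \<phi> (Dom A f) = \<phi> (Cod A f) \<cdot>\<^bsub>A\<^esub> amap L (amap R f)"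
    and "\<And>X. X \<in> Obj A \<Longrightarrow> \<epsilon> X \<cdot>\<^bsub>A\<^esub> \<phi> X = e X"
    and d: "\<And>X. X \<in> Obj A \<Longrightarrow> \<Delta> X \<cdot>\<^bsub>A\<^esub> \<phi> X =
           (\<phi> (omap G X) \<cdot>\<^bsub>A\<^esub> amap L (amap R (\<phi> X))) \<cdot>\<^bsub>A\<^esub> amap L (\<eta> (omap R X))"
  shows "comonad_mor \<phi>"
proof (intro comonad_morphism.intro nat_trans.intro nat_trans_axioms.intro
    comonad_morphism_axioms.intro, goal_cases)
  case 1 show ?case by (rule adjunction_comonad) (rule adj.adjunction_axioms)
next
  case 2 show ?case by (rule com.comonad_axioms)
next
  case 3 show ?case by (rule adj.counit.src.cat_functor_axioms)
next
  case 4 show ?case by (rule G.cat_functor_axioms)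
next
  case 5 show ?case by fact
next
  case (6 X) then show ?case using h[OF 6] by (simp add: comp_fctr_def)
next
  case (7 f X Y) then show ?case using n[of f] by (auto simp: comp_fctr_def hom_def)
next
  case (8 X) then show ?case using d[OF 8] h[OF 8]
    by (simp add: comp_fctr_def adj_comult_def hom_def)
next
  case (9 X) then show ?case by fact
qed

definition mor_of_coaction :: "('p \<Rightarrow> 'm) \<Rightarrow> 'o \<Rightarrow> 'm" where
  "mor_of_coaction k = (\<lambda>X\<in>Obj A. amap G (e X) \<cdot>\<^bsub>A\<^esub> k (omap R X))"

definition coaction_of_mor :: "('o \<Rightarrow> 'm) \<Rightarrow> 'p \<Rightarrow> 'm" where
  "coaction_of_mor \<phi> = (\<lambda>Y\<in>Obj B. \<phi> (omap L Y) \<cdot>\<^bsub>A\<^esub> amap L (\<eta> Y))"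

text \<open>
  Naturality is proved apart from the comonad morphism axioms because compatibility with the
  comultiplications already needs it, at the arrow \<open>\<phi> X\<close>.
\<close>

lemma mor_of_coaction_natural:
  assumes k: "coaction B A G \<Delta> \<epsilon> L k" and f: "f \<in> Arr A"
  shows "amap G f \<cdot>\<^bsub>A\<^esub> mor_of_coaction k (Dom A f)
           = mor_of_coaction k (Cod A f) \<cdot>\<^bsub>A\<^esub> amap L (amap R f)"
proof -
  note s = simps transformation_simps coactionD(2-4)[OF k] f
  let ?X = "Dom A f" and ?Y = "Cod A f"
  have "amap G f \<cdot>\<^bsub>A\<^esub> mor_of_coaction k ?X = amap G (f \<cdot>\<^bsub>A\<^esub> e ?X) \<cdot>\<^bsub>A\<^esub> k (omap R ?X)"
    by (simp add: mor_of_coaction_def s)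
  also have "\<dots> = amap G (e ?Y) \<cdot>\<^bsub>A\<^esub> (amap G (amap L (amap R f)) \<cdot>\<^bsub>A\<^esub> k (omap R ?X))"
    by (simp add: counit_natural[OF f] s)
  also have "\<dots> = amap G (e ?Y) \<cdot>\<^bsub>A\<^esub> (k (omap R ?Y) \<cdot>\<^bsub>A\<^esub> amap L (amap R f))"
    using coactionD(7)[OF k, of "amap R f"] by (simp add: s)
  also have "\<dots> = mor_of_coaction k ?Y \<cdot>\<^bsub>A\<^esub> amap L (amap R f)"
    by (simp add: mor_of_coaction_def s)
  finally show ?thesis .
qed

text \<open>
  Naturality of \<open>k\<close> at \<open>\<eta> Y\<close> moves the unit past \<open>k\<close>, where it cancels against the counit under
  \<open>G\<close> by the triangle identity for \<open>L\<close>.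
\<close>

lemma coaction_of_mor_of_coaction:
  assumes k: "coaction B A G \<Delta> \<epsilon> L k" and Y: "Y \<in> Obj B"
  shows "mor_of_coaction k (omap L Y) \<cdot>\<^bsub>A\<^esub> amap L (\<eta> Y) = k Y"
proof -
  note s = simps transformation_simps unit_simps coactionD(2-4)[OF k] Y
  have "mor_of_coaction k (omap L Y) \<cdot>\<^bsub>A\<^esub> amap L (\<eta> Y)
      = amap G (e (omap L Y)) \<cdot>\<^bsub>A\<^esub> (k (omap R (omap L Y)) \<cdot>\<^bsub>A\<^esub> amap L (\<eta> Y))"
    by (simp add: mor_of_coaction_def s)
  also have "\<dots> = amap G (e (omap L Y)) \<cdot>\<^bsub>A\<^esub> (amap G (amap L (\<eta> Y)) \<cdot>\<^bsub>A\<^esub> k Y)"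
    using coactionD(7)[OF k, of "\<eta> Y"] by (simp add: s)
  also have "\<dots> = amap G (e (omap L Y) \<cdot>\<^bsub>A\<^esub> amap L (\<eta> Y)) \<cdot>\<^bsub>A\<^esub> k Y"
    by (simp add: s)
  also have "\<dots> = k Y"
    by (simp only: adj.triangle_L[OF Y]) (simp add: s)
  finally show ?thesis .
qed

text \<open>
  Both sides of the comultiplication axiom equal \<open>G(\<phi> X) \<circ> k(R X)\<close>: the left-hand side by
  naturality of \<open>\<Delta>\<close> and coassociativity of \<open>k\<close>, the right-hand side by recovering \<open>k(R X)\<close> from
  \<open>\<phi>\<close> and naturality of \<open>\<phi>\<close> at \<open>\<phi> X\<close>.
\<close>

lemma comonad_mor_of_coaction:
  assumes k: "coaction B A G \<Delta> \<epsilon> L k"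
  shows "comonad_mor (mor_of_coaction k)"
proof (rule comonad_morI)
  note s = simps transformation_simps unit_simps coactionD(2-4)[OF k]
  let ?\<phi> = "mor_of_coaction k"
  show "?\<phi> \<in> extensional (Obj A)"
    by (simp add: mor_of_coaction_def)
  show h: "?\<phi> X \<in> hom A (omap L (omap R X)) (omap G X)" if "X \<in> Obj A" for X
    using that by (simp add: mor_of_coaction_def hom_def s)
  show "amap G f \<cdot>\<^bsub>A\<^esub> ?\<phi> (Dom A f) = ?\<phi> (Cod A f) \<cdot>\<^bsub>A\<^esub> amap L (amap R f)" if "f \<in> Arr A" for f
    by (rule mor_of_coaction_natural[OF k that])
  fix X assume X: "X \<in> Obj A"
  let ?Y = "omap R X"
  have "\<epsilon> X \<cdot>\<^bsub>A\<^esub> ?\<phi> X = (\<epsilon> X \<cdot>\<^bsub>A\<^esub> amap G (e X)) \<cdot>\<^bsub>A\<^esub> k ?Y"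
    by (simp add: mor_of_coaction_def s X)
  also have "\<dots> = e X \<cdot>\<^bsub>A\<^esub> (\<epsilon> (omap L ?Y) \<cdot>\<^bsub>A\<^esub> k ?Y)"
    using comonad_counit_natural[of "e X", symmetric] by (simp add: s X)
  also have "\<dots> = e X"
    by (simp add: coactionD(6)[OF k] s X)
  finally show "\<epsilon> X \<cdot>\<^bsub>A\<^esub> ?\<phi> X = e X" .
  have \<phi>: "?\<phi> X \<in> Arr A" "Dom A (?\<phi> X) = omap L (omap R X)" "Cod A (?\<phi> X) = omap G X"
    if "X \<in> Obj A" for X
    using h[OF that] by (simp_all add: hom_def)
  have "\<Delta> X \<cdot>\<^bsub>A\<^esub> ?\<phi> X = (\<Delta> X \<cdot>\<^bsub>A\<^esub> amap G (e X)) \<cdot>\<^bsub>A\<^esub> k ?Y"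
    by (simp add: mor_of_coaction_def s X)
  also have "\<dots> = amap G (amap G (e X)) \<cdot>\<^bsub>A\<^esub> (\<Delta> (omap L ?Y) \<cdot>\<^bsub>A\<^esub> k ?Y)"
    using comonad_comult_natural[of "e X", symmetric] by (simp add: s X)
  also have "\<dots> = amap G (amap G (e X)) \<cdot>\<^bsub>A\<^esub> (amap G (k ?Y) \<cdot>\<^bsub>A\<^esub> k ?Y)"
    by (simp add: coactionD(5)[OF k] s X)
  also have "\<dots> = amap G (?\<phi> X) \<cdot>\<^bsub>A\<^esub> k ?Y"
    by (simp add: mor_of_coaction_def s X)
  also have "\<dots> = amap G (?\<phi> X) \<cdot>\<^bsub>A\<^esub> (?\<phi> (omap L ?Y) \<cdot>\<^bsub>A\<^esub> amap L (\<eta> ?Y))"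
    by (simp add: coaction_of_mor_of_coaction[OF k] s X)
  also have "\<dots> = (amap G (?\<phi> X) \<cdot>\<^bsub>A\<^esub> ?\<phi> (omap L ?Y)) \<cdot>\<^bsub>A\<^esub> amap L (\<eta> ?Y)"
    using h[of "omap L ?Y"] by (simp add: s \<phi> X hom_def)
  also have "\<dots> = (?\<phi> (omap G X) \<cdot>\<^bsub>A\<^esub> amap L (amap R (?\<phi> X))) \<cdot>\<^bsub>A\<^esub> amap L (\<eta> ?Y)"
    using mor_of_coaction_natural[OF k \<phi>(1)[OF X]] by (simp only: \<phi>[OF X])
  finally show "\<Delta> X \<cdot>\<^bsub>A\<^esub> ?\<phi> X
      = (?\<phi> (omap G X) \<cdot>\<^bsub>A\<^esub> amap L (amap R (?\<phi> X))) \<cdot>\<^bsub>A\<^esub> amap L (\<eta> ?Y)" .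
qed

text \<open>Dually, naturality of \<open>\<phi>\<close> at \<open>e X\<close> exposes the triangle identity for \<open>R\<close>.\<close>

lemma mor_of_coaction_of_mor:
  assumes \<phi>: "comonad_mor \<phi>" and X: "X \<in> Obj A"
  shows "amap G (e X) \<cdot>\<^bsub>A\<^esub> coaction_of_mor \<phi> (omap R X) = \<phi> X"
proof -
  note s = simps transformation_simps unit_simps comonad_morD(2-4)[OF \<phi>] X
  let ?Y = "omap R X"
  have "amap G (e X) \<cdot>\<^bsub>A\<^esub> coaction_of_mor \<phi> ?Y
      = (amap G (e X) \<cdot>\<^bsub>A\<^esub> \<phi> (omap L ?Y)) \<cdot>\<^bsub>A\<^esub> amap L (\<eta> ?Y)"
    by (simp add: coaction_of_mor_def s)
  also have "\<dots> = \<phi> X \<cdot>\<^bsub>A\<^esub> amap L (amap R (e X) \<cdot>\<^bsub>B\<^esub> \<eta> ?Y)"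
    using comonad_morD(5)[OF \<phi>, of "e X"] by (simp add: s)
  also have "\<dots> = \<phi> X"
    by (simp only: adj.triangle_R[OF X]) (simp add: s)
  finally show ?thesis .
qed

text \<open>
  The comultiplication axiom for \<open>\<phi>\<close> at \<open>L Y\<close> produces the unit at \<open>RL Y\<close>.  Precomposed with
  \<open>\<eta> Y\<close> it may be replaced by \<open>RL(\<eta> Y)\<close>, after which \<open>\<phi>(L Y)\<close> and \<open>L(\<eta> Y)\<close> combine to
  \<open>k Y\<close> under \<open>LR\<close>, and naturality of \<open>\<phi>\<close> at \<open>k Y\<close> applies.
\<close>

lemma coaction_of_comonad_mor:
  assumes \<phi>: "comonad_mor \<phi>"
  shows "coaction B A G \<Delta> \<epsilon> L (coaction_of_mor \<phi>)"
proof (rule coactionI)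
  note s = simps transformation_simps unit_simps comonad_morD(2-4)[OF \<phi>]
  let ?k = "coaction_of_mor \<phi>"
  show "?k \<in> extensional (Obj B)"
    by (simp add: coaction_of_mor_def)
  show h: "?k Y \<in> hom A (omap L Y) (omap G (omap L Y))" if "Y \<in> Obj B" for Y
    using that by (simp add: coaction_of_mor_def hom_def s)
  show "amap G (amap L g) \<cdot>\<^bsub>A\<^esub> ?k (Dom B g) = ?k (Cod B g) \<cdot>\<^bsub>A\<^esub> amap L g"
    if g: "g \<in> Arr B" for g
  proof -
    let ?X = "Dom B g" and ?Y = "Cod B g"
    have "amap G (amap L g) \<cdot>\<^bsub>A\<^esub> ?k ?X
        = (amap G (amap L g) \<cdot>\<^bsub>A\<^esub> \<phi> (omap L ?X)) \<cdot>\<^bsub>A\<^esub> amap L (\<eta> ?X)"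
      by (simp add: coaction_of_mor_def s g)
    also have "\<dots> = \<phi> (omap L ?Y) \<cdot>\<^bsub>A\<^esub> amap L (amap R (amap L g) \<cdot>\<^bsub>B\<^esub> \<eta> ?X)"
      using comonad_morD(5)[OF \<phi>, of "amap L g"] by (simp add: s g)
    also have "\<dots> = ?k ?Y \<cdot>\<^bsub>A\<^esub> amap L g"
      by (simp only: unit_natural[OF g]) (simp add: coaction_of_mor_def s g)
    finally show ?thesis .
  qed
  fix Y assume Y: "Y \<in> Obj B"
  let ?X = "omap L Y"
  have "\<epsilon> ?X \<cdot>\<^bsub>A\<^esub> ?k Y = (\<epsilon> ?X \<cdot>\<^bsub>A\<^esub> \<phi> ?X) \<cdot>\<^bsub>A\<^esub> amap L (\<eta> Y)"
    by (simp add: coaction_of_mor_def s Y)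
  also have "\<dots> = Id A ?X"
    using adj.triangle_L[OF Y] by (simp add: comonad_morD(6)[OF \<phi>] s Y)
  finally show "\<epsilon> ?X \<cdot>\<^bsub>A\<^esub> ?k Y = Id A ?X" .
  have k: "?k Y \<in> Arr A" "Dom A (?k Y) = ?X" "Cod A (?k Y) = omap G ?X"
    using h[OF Y] by (simp_all add: hom_def)
  have "\<Delta> ?X \<cdot>\<^bsub>A\<^esub> ?k Y = (\<Delta> ?X \<cdot>\<^bsub>A\<^esub> \<phi> ?X) \<cdot>\<^bsub>A\<^esub> amap L (\<eta> Y)"
    by (simp add: coaction_of_mor_def s Y)
  also have "\<dots> = \<phi> (omap G ?X) \<cdot>\<^bsub>A\<^esub> (amap L (amap R (\<phi> ?X)) \<cdot>\<^bsub>A\<^esub>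
      amap L (\<eta> (omap R ?X) \<cdot>\<^bsub>B\<^esub> \<eta> Y))"
    by (simp add: comonad_morD(7)[OF \<phi>] s Y)
  also have "\<eta> (omap R ?X) \<cdot>\<^bsub>B\<^esub> \<eta> Y = amap R (amap L (\<eta> Y)) \<cdot>\<^bsub>B\<^esub> \<eta> Y"
    using unit_natural[of "\<eta> Y"] by (simp add: s Y)
  also have "\<phi> (omap G ?X) \<cdot>\<^bsub>A\<^esub> (amap L (amap R (\<phi> ?X)) \<cdot>\<^bsub>A\<^esub>
      amap L (amap R (amap L (\<eta> Y)) \<cdot>\<^bsub>B\<^esub> \<eta> Y))
      = (\<phi> (omap G ?X) \<cdot>\<^bsub>A\<^esub> amap L (amap R (?k Y))) \<cdot>\<^bsub>A\<^esub> amap L (\<eta> Y)"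
    by (simp add: coaction_of_mor_def s Y)
  also have "\<dots> = (amap G (?k Y) \<cdot>\<^bsub>A\<^esub> \<phi> ?X) \<cdot>\<^bsub>A\<^esub> amap L (\<eta> Y)"
    using comonad_morD(5)[OF \<phi> k(1)] by (simp only: k)
  also have "\<dots> = amap G (?k Y) \<cdot>\<^bsub>A\<^esub> ?k Y"
    by (simp add: coaction_of_mor_def s Y)
  finally show "amap G (?k Y) \<cdot>\<^bsub>A\<^esub> ?k Y = \<Delta> ?X \<cdot>\<^bsub>A\<^esub> ?k Y" ..
qed

lemma bij_betw_coactions_comonad_morphisms:
  "bij_betw mor_of_coaction {k. coaction B A G \<Delta> \<epsilon> L k} {\<phi>. comonad_mor \<phi>}"
proof (rule bij_betw_byWitness[where f' = coaction_of_mor])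
  show "\<forall>k\<in>{k. coaction B A G \<Delta> \<epsilon> L k}. coaction_of_mor (mor_of_coaction k) = k"
  proof
    fix k assume "k \<in> {k. coaction B A G \<Delta> \<epsilon> L k}"
    then have k: "coaction B A G \<Delta> \<epsilon> L k" ..
    show "coaction_of_mor (mor_of_coaction k) = k"
      by (rule extensionalityI[OF _ coactionD(1)[OF k]])
        (simp_all add: coaction_of_mor_def coaction_of_mor_of_coaction[OF k])
  qed
  show "\<forall>\<phi>\<in>{\<phi>. comonad_mor \<phi>}. mor_of_coaction (coaction_of_mor \<phi>) = \<phi>"
  proof
    fix \<phi> assume "\<phi> \<in> {\<phi>. comonad_mor \<phi>}"
    then have \<phi>: "comonad_mor \<phi>" ..
    show "mor_of_coaction (coaction_of_mor \<phi>) = \<phi>"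
      by (rule extensionalityI[OF _ comonad_morD(1)[OF \<phi>]])
        (simp_all add: mor_of_coaction_def mor_of_coaction_of_mor[OF \<phi>])
  qed
  show "mor_of_coaction ` {k. coaction B A G \<Delta> \<epsilon> L k} \<subseteq> {\<phi>. comonad_mor \<phi>}"
    by (auto intro: comonad_mor_of_coaction)
  show "coaction_of_mor ` {\<phi>. comonad_mor \<phi>} \<subseteq> {k. coaction B A G \<Delta> \<epsilon> L k}"
    by (auto intro: coaction_of_comonad_mor)
qed

end

section \<open>Lifts and comonad morphisms\<close>

theorem mainTheorem2:
  fixes A :: "('o, 'm) cat" and B :: "('p, 'n) cat"
    and G :: "('o, 'm, 'o, 'm) fctr" and \<Delta> \<epsilon> :: "'o \<Rightarrow> 'm"
    and L :: "('p, 'n, 'o, 'm) fctr" and R :: "('o, 'm, 'p, 'n) fctr"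
    and \<eta> :: "'p \<Rightarrow> 'n" and e :: "'o \<Rightarrow> 'm"
  assumes "comonad A G \<Delta> \<epsilon>"
    and "cat_functor B A L"
    and "adjunction B A L R \<eta> e"
  shows "\<exists>\<Phi>. bij_betw \<Phi>
           {K. cat_functor B (coalg_cat A G \<Delta> \<epsilon>) K \<and>
               comp_fctr B (forgetful A G \<Delta> \<epsilon>) K = L}
           {\<phi>. comonad_morphism A (comp_fctr A L R) (adj_comult A L R \<eta>) e G \<Delta> \<epsilon> \<phi>} \<and>
         (\<forall>K. cat_functor B (coalg_cat A G \<Delta> \<epsilon>) K \<longrightarrow>
              comp_fctr B (forgetful A G \<Delta> \<epsilon>) K = L \<longrightarrow>
              (\<forall>X\<in>Obj A. \<Phi> K X = amap G (e X) \<cdot>\<^bsub>A\<^esub> snd (omap K (omap R X))))"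
proof -
  interpret G: comonad A G \<Delta> \<epsilon> by fact
  interpret adj: adjunction B A L R \<eta> e by fact
  interpret comonad_adjunction A G \<Delta> \<epsilon> B L R \<eta> e ..
  let ?\<Phi> = "mor_of_coaction \<circ> (\<lambda>K. \<lambda>Y\<in>Obj B. snd (omap K Y))"
  have "bij_betw ?\<Phi>
      {K. cat_functor B (coalg_cat A G \<Delta> \<epsilon>) K \<and> comp_fctr B (forgetful A G \<Delta> \<epsilon>) K = L}
      {\<phi>. comonad_mor \<phi>}"
    using bij_betw_lifts_coactions[OF assms(1,2)] bij_betw_coactions_comonad_morphisms
    by (rule bij_betw_trans)
  moreover have "?\<Phi> K X = amap G (e X) \<cdot>\<^bsub>A\<^esub> snd (omap K (omap R X))" if "X \<in> Obj A" for K X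
    using that by (simp add: mor_of_coaction_def adj.right.omap_Obj)
  ultimately show ?thesis by blast
qed

end
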